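(* Let $(G,\ell,u)$ be a graph with interval costs, let $s,t\in\mathcal V(G)$, and let $(G,w)$ be the multi-objective shortest path (MOSP) instance induced by $(G,\ell,u,s)$. (1) The complete set of shortest $s$-$t$-paths of $(G,\ell,u)$ equals the set of weakly efficient $s$-$t$-paths of $(G,w)$: $\mathbf P_{s,t}=\mathbb P_{st}^{<_D}$. In particular, solving the Complete Interval Shortest Path Problem (finding $\mathbf P_{s,t}$) is equivalent to finding the set of weakly efficient paths of the induced MOSP instance. (2) For every essential set $\hat{\mathbf P}_{s,t}$ of shortest $s$-$t$-paths of $(G,\ell,u)$ we have $\mathbf W(\hat{\mathbf P}_{s,t})=\mathbf W(\mathbb P_{st}^{\le_D})$. In particular, solving the Essential Interval Shortest Path Problem is equivalent to finding an (inclusion-)minimal set $M$ of efficient paths of the induced MOSP instance with $\mathbf W(M)=\mathbf W(\mathbb P_{st}^{\le_D})$; that is, a set $M$ of $s$-$t$-paths is an essential set if and only if it is a minimal set of efficient $s$-$t$-paths with $\mathbf W(M)=\mathbf W(\mathbb P_{st}^{\le_D})$.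
   Context: A graph with interval costs $(G,\ell,u)$ is a finite directed graph $G$ (parallel arcs allowed) with node set $\mathcal V(G)$, arc set $\mathcal A(G)$, and $\ell,u\in\mathbb R^{\mathcal A(G)}$ with $0\le \ell_a\le u_a$ for all arcs $a$. A scenario is a vector $c\in[\boldsymbol\ell,\boldsymbol u]:=\prod_{a\in\mathcal A(G)}[\ell_a,u_a]$; $\mathcal E([\boldsymbol\ell,\boldsymbol u])$ is the set of all vectors $(x_a)_{a\in\mathcal A(G)}$ with $x_a\in\{\ell_a,u_a\}$. All paths are simple; $\mathcal P_{s,t}$ is the set of all $s$-$t$-paths in $G$, $\mathcal A(p)$ is the arc set of the path $p$, and $c(p):=\sum_{a\in\mathcal A(p)}c_a$. For $c\in[\boldsymbol\ell,\boldsymbol u]$ let $\mathbf P^c_{s,t}$ be the set of all $p\in\mathcal P_{s,t}$ with $c(p)\le c(p')$ for all $p'\in\mathcal P_{s,t}$ (shortest paths w.r.t. $c$). The complete set of shortest paths is $\mathbf P_{s,t}:=\bigcup_{c\in[\boldsymbol\ell,\boldsymbol u]}\mathbf P^c_{s,t}$. A set $M\subseteq\mathcal P_{s,t}$ is scenario-covering if for every $c\in[\boldsymbol\ell,\boldsymbol u]$ some $p\in M$ is a shortest $s$-$t$-path w.r.t. $c$. An essential set of shortest paths, denoted $\hat{\mathbf P}_{s,t}$, is a scenario-covering set such that for each of its elements $p$, the set $\hat{\mathbf P}_{s,t}\setminus\{p\}$ is not scenario-covering. The Essential Interval Shortest Path Problem consists in finding such a set. The MOSP instance $(G,w)$ induced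 by $(G,\ell,u,s)$ has arc weights $w:\mathcal A(G)\to\mathbb R^{\mathcal E([\boldsymbol\ell,\boldsymbol u])}$, $w(a):=(c_a)_{c\in\mathcal E([\boldsymbol\ell,\boldsymbol u])}$, and path weights $w(p):=\sum_{a\in\mathcal A(p)}w(a)$. For $p,p'\in\mathcal P_{s,t}$: $p\le_D p'$ iff $w(p)_j\le w(p')_j$ for all coordinates $j$ and $w(p)_i<w(p')_i$ for some coordinate $i$; $p<_D p'$ iff $w(p)_j<w(p')_j$ for all coordinates $j$. A path $p\in\mathcal P_{s,t}$ is efficient if no $p'\in\mathcal P_{s,t}$ satisfies $p'\le_D p$, and weakly efficient if no $p'\in\mathcal P_{s,t}$ satisfies $p'<_D p$. The sets of efficient and weakly efficient $s$-$t$-paths are denoted $\mathbb P_{st}^{\le_D}$ and $\mathbb P_{st}^{<_D}$, respectively. For a set $P$ of $s$-$t$-paths, $\mathbf W(P):=\{w(p):p\in P\}$.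
   Formalization: The final "if and only if" in (2) is stated only when at least one s-t-path exists; otherwise the empty set is a minimal set of efficient paths but is not scenario-covering, so the "if" direction fails. The rest of (1) and (2) is proved without this assumption. *)

theory Defs
  imports Complex_Main "HOL-Library.FuncSet" "Graph_Theory.Arc_Walk"
begin

section \<open>Graphs with interval costs\<close>

text \<open>Parallel arcs and loops are allowed; only the values of the bounds on \<open>arcs G\<close> matter.\<close>

locale interval_graph = fin_digraph G
  for G :: "('v, 'a) pre_digraph" +
  fixes l u :: "'a \<Rightarrow> real"
  assumes nonneg_lower: "a \<in> arcs G \<Longrightarrow> 0 \<le> l a"
    and lower_le_upper: "a \<in> arcs G \<Longrightarrow> l a \<le> u a"

text \<open>Vectors indexed by the arcs are extensional functions on \<open>arcs G\<close>, so that equality of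
  functions is equality of vectors.\<close>

definition scenarios :: "('v, 'a) pre_digraph \<Rightarrow> ('a \<Rightarrow> real) \<Rightarrow> ('a \<Rightarrow> real) \<Rightarrow> ('a \<Rightarrow> real) set" where
  "scenarios G l u = (\<Pi>\<^sub>E a\<in>arcs G. {l a..u a})"

definition extremal_scenarios ::
    "('v, 'a) pre_digraph \<Rightarrow> ('a \<Rightarrow> real) \<Rightarrow> ('a \<Rightarrow> real) \<Rightarrow> ('a \<Rightarrow> real) set" where
  "extremal_scenarios G l u = (\<Pi>\<^sub>E a\<in>arcs G. {l a, u a})"

text \<open>Paths are arc lists without repeated nodes. In particular, the empty list is the only path
  from a node to itself.\<close>

definition st_paths :: "('v, 'a) pre_digraph \<Rightarrow> 'v \<Rightarrow> 'v \<Rightarrow> 'a list set" where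
  "st_paths G s t = {p. pre_digraph.apath G s p t}"

definition path_cost :: "('a \<Rightarrow> real) \<Rightarrow> 'a list \<Rightarrow> real" where
  "path_cost c p = (\<Sum>a\<in>set p. c a)"

definition shortest_paths ::
    "('v, 'a) pre_digraph \<Rightarrow> ('a \<Rightarrow> real) \<Rightarrow> 'v \<Rightarrow> 'v \<Rightarrow> 'a list set" where
  "shortest_paths G c s t =
    {p \<in> st_paths G s t. \<forall>p'\<in>st_paths G s t. path_cost c p \<le> path_cost c p'}"

definition complete_paths ::
    "('v, 'a) pre_digraph \<Rightarrow> ('a \<Rightarrow> real) \<Rightarrow> ('a \<Rightarrow> real) \<Rightarrow> 'v \<Rightarrow> 'v \<Rightarrow> 'a list set" where
  "complete_paths G l u s t = (\<Union>c\<in>scenarios G l u. shortest_paths G c s t)"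

definition scenario_covering ::
    "('v, 'a) pre_digraph \<Rightarrow> ('a \<Rightarrow> real) \<Rightarrow> ('a \<Rightarrow> real) \<Rightarrow> 'v \<Rightarrow> 'v \<Rightarrow> 'a list set \<Rightarrow> bool" where
  "scenario_covering G l u s t M \<longleftrightarrow>
    M \<subseteq> st_paths G s t \<and> (\<forall>c\<in>scenarios G l u. \<exists>p\<in>M. p \<in> shortest_paths G c s t)"

definition essential ::
    "('v, 'a) pre_digraph \<Rightarrow> ('a \<Rightarrow> real) \<Rightarrow> ('a \<Rightarrow> real) \<Rightarrow> 'v \<Rightarrow> 'v \<Rightarrow> 'a list set \<Rightarrow> bool" where
  "essential G l u s t M \<longleftrightarrow>
    scenario_covering G l u s t M \<and> (\<forall>p\<in>M. \<not> scenario_covering G l u s t (M - {p}))"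

section \<open>Multi-objective shortest paths\<close>

text \<open>An instance is given by a digraph, an index set \<open>J\<close> of objectives, and arc weights \<open>w\<close>, where
  \<open>w a\<close> is a vector indexed by \<open>J\<close>.\<close>

definition mosp_weight :: "'j set \<Rightarrow> ('a \<Rightarrow> 'j \<Rightarrow> real) \<Rightarrow> 'a list \<Rightarrow> 'j \<Rightarrow> real" where
  "mosp_weight J w p = (\<lambda>j\<in>J. \<Sum>a\<in>set p. w a j)"

definition dominates :: "'j set \<Rightarrow> ('a \<Rightarrow> 'j \<Rightarrow> real) \<Rightarrow> 'a list \<Rightarrow> 'a list \<Rightarrow> bool" where
  "dominates J w p p' \<longleftrightarrow>
    (\<forall>j\<in>J. mosp_weight J w p j \<le> mosp_weight J w p' j) \<and>
    (\<exists>i\<in>J. mosp_weight J w p i < mosp_weight J w p' i)"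

definition strictly_dominates :: "'j set \<Rightarrow> ('a \<Rightarrow> 'j \<Rightarrow> real) \<Rightarrow> 'a list \<Rightarrow> 'a list \<Rightarrow> bool" where
  "strictly_dominates J w p p' \<longleftrightarrow> (\<forall>j\<in>J. mosp_weight J w p j < mosp_weight J w p' j)"

definition efficient_paths ::
    "('v, 'a) pre_digraph \<Rightarrow> 'j set \<Rightarrow> ('a \<Rightarrow> 'j \<Rightarrow> real) \<Rightarrow> 'v \<Rightarrow> 'v \<Rightarrow> 'a list set" where
  "efficient_paths G J w s t =
    {p \<in> st_paths G s t. \<not> (\<exists>p'\<in>st_paths G s t. dominates J w p' p)}"

definition weakly_efficient_paths ::
    "('v, 'a) pre_digraph \<Rightarrow> 'j set \<Rightarrow> ('a \<Rightarrow> 'j \<Rightarrow> real) \<Rightarrow> 'v \<Rightarrow> 'v \<Rightarrow> 'a list set" where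
  "weakly_efficient_paths G J w s t =
    {p \<in> st_paths G s t. \<not> (\<exists>p'\<in>st_paths G s t. strictly_dominates J w p' p)}"

definition minimal_efficient_set ::
    "('v, 'a) pre_digraph \<Rightarrow> 'j set \<Rightarrow> ('a \<Rightarrow> 'j \<Rightarrow> real) \<Rightarrow> 'v \<Rightarrow> 'v \<Rightarrow> 'a list set \<Rightarrow> bool" where
  "minimal_efficient_set G J w s t M \<longleftrightarrow>
    M \<subseteq> efficient_paths G J w s t \<and>
    mosp_weight J w ` M = mosp_weight J w ` efficient_paths G J w s t \<and>
    \<not> (\<exists>M'. M' \<subset> M \<and> mosp_weight J w ` M' = mosp_weight J w ` efficient_paths G J w s t)"

text \<open>The MOSP instance induced by a graph with interval costs has one objective for each extremal
  scenario.\<close>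

definition induced_weight ::
    "('v, 'a) pre_digraph \<Rightarrow> ('a \<Rightarrow> real) \<Rightarrow> ('a \<Rightarrow> real) \<Rightarrow> 'a \<Rightarrow> ('a \<Rightarrow> real) \<Rightarrow> real" where
  "induced_weight G l u a = (\<lambda>c\<in>extremal_scenarios G l u. c a)"

end

theory Submission
  imports Defs
begin

text \<open>
  The proof rests on one scenario per path \<open>p\<close>: its best case, in which the arcs of \<open>p\<close> take their
  lower bounds and all other arcs their upper bounds. Arcs shared by \<open>p\<close> and a competitor \<open>q\<close> cancel
  in the difference \<open>c(p) - c(q)\<close>, so this difference is smallest in the best case of \<open>p\<close>
  (\<open>cost_difference_least_in_best_case\<close>). Hence the best case alone decides how \<open>p\<close> compares with
  \<open>q\<close>: if \<open>q\<close> is at most as expensive (or strictly cheaper) there, it is so in every scenario. Since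
  the best case is an extremal scenario, it is also one of the objectives of the induced instance.

  For the complete set, this says that \<open>p\<close> is shortest in some scenario iff it is shortest in its
  best case, iff no path is strictly cheaper than \<open>p\<close> in all extremal scenarios.

  For essential sets, the crucial fact is that, when there is at least one path, a set \<open>M\<close> of paths
  is scenario-covering iff its weights include those of all efficient paths
  (\<open>scenario_covering_iff_efficient_weights\<close>). If \<open>M\<close> covers the best case of an efficient \<open>p\<close>, the
  covering path is nowhere worse than \<open>p\<close>, so by efficiency it has the same weight. Conversely, below
  each shortest path of a scenario there is an efficient one, because there are finitely many paths,
  and any representative of its weight is again shortest. The essential sets, being the minimal
  scenario-covering ones, are therefore exactly the minimal sets representing the weights of the
  efficient paths; redundant weights do not survive minimality.
\<close>

section \<open>Weights and efficiency\<close>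

lemma mosp_weight_eq_iff:
  "mosp_weight J w p = mosp_weight J w q \<longleftrightarrow> (\<forall>j\<in>J. mosp_weight J w p j = mosp_weight J w q j)"
  by (auto simp: mosp_weight_def fun_eq_iff)

text \<open>Efficiency is a property of the weight of a path, so any path sharing its weight with an
  efficient one is efficient.\<close>

lemma efficient_paths_same_weight:
  assumes "p \<in> efficient_paths G J w s t" "q \<in> st_paths G s t"
    and "mosp_weight J w q = mosp_weight J w p"
  shows "q \<in> efficient_paths G J w s t"
  using assms by (simp add: efficient_paths_def dominates_def)

text \<open>A path that dominates another has the smaller total weight over all objectives. So among the
  finitely many paths that are nowhere worse than \<open>p\<close>, one of least total weight is efficient.\<close>

lemma ex_efficient_path_below:
  assumes fin: "finite (st_paths G s t)" "finite J" and p: "p \<in> st_paths G s t"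
  obtains q where "q \<in> efficient_paths G J w s t"
    and "\<forall>j\<in>J. mosp_weight J w q j \<le> mosp_weight J w p j"
proof -
  define S where
    "S = {q \<in> st_paths G s t. \<forall>j\<in>J. mosp_weight J w q j \<le> mosp_weight J w p j}"
  let ?total = "\<lambda>q. \<Sum>j\<in>J. mosp_weight J w q j"
  have "finite S" "S \<noteq> {}" using fin p by (auto simp: S_def)
  then obtain q where q: "q \<in> S" and least: "\<And>r. r \<in> S \<Longrightarrow> ?total q \<le> ?total r"
    using arg_min_if_finite[of S ?total] by (metis not_less)
  have "\<not> dominates J w r q" if "r \<in> st_paths G s t" for r
  proof
    assume dom: "dominates J w r q"
    then have "?total r < ?total q"
      using fin by (auto simp: dominates_def intro!: sum_strict_mono_ex1)
    moreover have "r \<in> S" using that q dom by (force simp: S_def dominates_def)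
    ultimately show False using least by fastforce
  qed
  with q show thesis by (intro that[of q]) (auto simp: S_def efficient_paths_def)
qed

section \<open>Best-case scenarios\<close>

definition best_case ::
    "('v, 'a) pre_digraph \<Rightarrow> ('a \<Rightarrow> real) \<Rightarrow> ('a \<Rightarrow> real) \<Rightarrow> 'a list \<Rightarrow> 'a \<Rightarrow> real" where
  "best_case G l u p = (\<lambda>a\<in>arcs G. if a \<in> set p then l a else u a)"

lemma path_cost_diff_cancel:
  "path_cost c p - path_cost c q = sum c (set p - set q) - sum c (set q - set p)"
proof -
  have "sum c (set p) = sum c (set p \<inter> set q) + sum c (set p - set q)"
    by (rule sum.Int_Diff) simp
  moreover have "sum c (set q) = sum c (set q \<inter> set p) + sum c (set q - set p)"
    by (rule sum.Int_Diff) simp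
  ultimately show ?thesis by (simp add: path_cost_def Int_commute)
qed

context interval_graph
begin

lemma st_path_arcs: "p \<in> st_paths G s t \<Longrightarrow> set p \<subseteq> arcs G"
  by (auto simp: st_paths_def apath_def awalk_def)

lemma finite_st_paths: "finite (st_paths G s t)"
  by (simp add: st_paths_def apaths_finite)

lemma finite_extremal_scenarios: "finite (extremal_scenarios G l u)"
  by (auto simp: extremal_scenarios_def intro!: finite_PiE)

lemma extremal_scenarios_subset: "extremal_scenarios G l u \<subseteq> scenarios G l u"
  unfolding extremal_scenarios_def scenarios_def
  by (rule PiE_mono) (auto simp: lower_le_upper)

lemma best_case_extremal: "best_case G l u p \<in> extremal_scenarios G l u"
  by (auto simp: best_case_def extremal_scenarios_def)

lemma best_case_scenario: "best_case G l u p \<in> scenarios G l u"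
  using best_case_extremal extremal_scenarios_subset by blast

lemma mosp_weight_induced:
  "c \<in> extremal_scenarios G l u \<Longrightarrow>
    mosp_weight (extremal_scenarios G l u) (induced_weight G l u) p c = path_cost c p"
  by (simp add: mosp_weight_def induced_weight_def path_cost_def)

text \<open>Only arcs on exactly one of the two paths contribute to the difference. Those of \<open>p\<close> cost at
  least their lower bounds, those of \<open>q\<close> at most their upper bounds, and both bounds are attained in
  the best case of \<open>p\<close>.\<close>

lemma cost_difference_least_in_best_case:
  assumes "set p \<subseteq> arcs G" "set q \<subseteq> arcs G" and "c \<in> scenarios G l u"
  shows "path_cost (best_case G l u p) p - path_cost (best_case G l u p) q
    \<le> path_cost c p - path_cost c q"
proof -
  have bounds: "l a \<le> c a" "c a \<le> u a" if "a \<in> arcs G" for a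
    using assms(3) that by (auto simp: scenarios_def dest: PiE_mem)
  have "sum (best_case G l u p) (set p - set q) \<le> sum c (set p - set q)"
    using assms bounds by (intro sum_mono) (auto simp: best_case_def)
  moreover have "sum c (set q - set p) \<le> sum (best_case G l u p) (set q - set p)"
    using assms bounds by (intro sum_mono) (auto simp: best_case_def)
  ultimately show ?thesis unfolding path_cost_diff_cancel by linarith
qed

lemma no_worse_if_no_worse_in_best_case:
  assumes "p \<in> st_paths G s t" "q \<in> st_paths G s t" "c \<in> scenarios G l u"
    and "path_cost (best_case G l u p) q \<le> path_cost (best_case G l u p) p"
  shows "path_cost c q \<le> path_cost c p"
  using cost_difference_least_in_best_case[of p q c] assms st_path_arcs by fastforce

section \<open>Complete sets and weak efficiency\<close>

lemma complete_paths_iff_shortest_in_best_case: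
  "p \<in> complete_paths G l u s t \<longleftrightarrow> p \<in> shortest_paths G (best_case G l u p) s t"
proof
  assume "p \<in> complete_paths G l u s t"
  then obtain c where c: "c \<in> scenarios G l u" and p: "p \<in> shortest_paths G c s t"
    by (auto simp: complete_paths_def)
  have "path_cost (best_case G l u p) p \<le> path_cost (best_case G l u p) q"
    if "q \<in> st_paths G s t" for q
    using cost_difference_least_in_best_case[of p q c] p that c st_path_arcs
    by (fastforce simp: shortest_paths_def)
  with p show "p \<in> shortest_paths G (best_case G l u p) s t"
    by (simp add: shortest_paths_def)
qed (use best_case_scenario in \<open>auto simp: complete_paths_def\<close>)

lemma strictly_dominates_iff_cheaper_in_best_case:
  assumes "p \<in> st_paths G s t" "q \<in> st_paths G s t"
  shows "strictly_dominates (extremal_scenarios G l u) (induced_weight G l u) q p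
    \<longleftrightarrow> path_cost (best_case G l u p) q < path_cost (best_case G l u p) p"
proof
  assume cheaper: "path_cost (best_case G l u p) q < path_cost (best_case G l u p) p"
  have "path_cost c q < path_cost c p" if "c \<in> extremal_scenarios G l u" for c
    using cost_difference_least_in_best_case[of p q c] assms st_path_arcs cheaper that
      extremal_scenarios_subset by fastforce
  then show "strictly_dominates (extremal_scenarios G l u) (induced_weight G l u) q p"
    by (simp add: strictly_dominates_def mosp_weight_induced)
next
  assume "strictly_dominates (extremal_scenarios G l u) (induced_weight G l u) q p"
  then show "path_cost (best_case G l u p) q < path_cost (best_case G l u p) p"
    using best_case_extremal[of p] by (auto simp: strictly_dominates_def mosp_weight_induced)
qed

lemma complete_paths_eq_weakly_efficient_paths:
  "complete_paths G l u s t =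
    weakly_efficient_paths G (extremal_scenarios G l u) (induced_weight G l u) s t"
proof (rule set_eqI)
  fix p
  show "p \<in> complete_paths G l u s t \<longleftrightarrow>
      p \<in> weakly_efficient_paths G (extremal_scenarios G l u) (induced_weight G l u) s t"
    using strictly_dominates_iff_cheaper_in_best_case[of p s t]
    unfolding complete_paths_iff_shortest_in_best_case shortest_paths_def weakly_efficient_paths_def
      mem_Collect_eq not_less[symmetric] by blast
qed

section \<open>Essential sets and efficiency\<close>

text \<open>The objectives range over the extremal scenarios only, but the best case of \<open>p\<close> is among them
  and controls all scenarios.\<close>

lemma no_worse_in_all_scenarios:
  assumes "p \<in> st_paths G s t" "q \<in> st_paths G s t" "c \<in> scenarios G l u"
    and "\<forall>j\<in>extremal_scenarios G l u.
      mosp_weight (extremal_scenarios G l u) (induced_weight G l u) q j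
      \<le> mosp_weight (extremal_scenarios G l u) (induced_weight G l u) p j"
  shows "path_cost c q \<le> path_cost c p"
  using assms best_case_extremal[of p]
  by (intro no_worse_if_no_worse_in_best_case[OF assms(1-3)]) (auto simp: mosp_weight_induced)

text \<open>A path that covers the best case of an efficient path \<open>p\<close> is nowhere worse than \<open>p\<close>, and by
  efficiency nowhere better.\<close>

lemma efficient_weight_determined_by_best_case:
  assumes p: "p \<in> efficient_paths G (extremal_scenarios G l u) (induced_weight G l u) s t"
    and q: "q \<in> shortest_paths G (best_case G l u p) s t"
  shows "mosp_weight (extremal_scenarios G l u) (induced_weight G l u) q
    = mosp_weight (extremal_scenarios G l u) (induced_weight G l u) p"
proof -
  have paths: "p \<in> st_paths G s t" "q \<in> st_paths G s t"
    using p q by (auto simp: efficient_paths_def shortest_paths_def)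
  have le: "path_cost c q \<le> path_cost c p" if "c \<in> extremal_scenarios G l u" for c
    using no_worse_if_no_worse_in_best_case[OF paths] that q paths extremal_scenarios_subset
    by (auto simp: shortest_paths_def)
  have "\<not> dominates (extremal_scenarios G l u) (induced_weight G l u) q p"
    using p paths by (auto simp: efficient_paths_def)
  with le show ?thesis
    by (force simp: dominates_def mosp_weight_eq_iff mosp_weight_induced not_less)
qed

lemma scenario_covering_iff_efficient_weights:
  fixes s t
  defines "J \<equiv> extremal_scenarios G l u" and "w \<equiv> induced_weight G l u"
  assumes nonempty: "st_paths G s t \<noteq> {}"
  shows "scenario_covering G l u s t M \<longleftrightarrow> M \<subseteq> st_paths G s t \<and>
    mosp_weight J w ` efficient_paths G J w s t \<subseteq> mosp_weight J w ` M"
proof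
  assume cov: "scenario_covering G l u s t M"
  have "mosp_weight J w p \<in> mosp_weight J w ` M" if p: "p \<in> efficient_paths G J w s t" for p
  proof -
    obtain q where "q \<in> M" "q \<in> shortest_paths G (best_case G l u p) s t"
      using cov best_case_scenario[of p] unfolding scenario_covering_def by blast
    then show ?thesis
      using efficient_weight_determined_by_best_case p unfolding J_def w_def
      by (metis image_eqI)
  qed
  with cov show "M \<subseteq> st_paths G s t \<and>
      mosp_weight J w ` efficient_paths G J w s t \<subseteq> mosp_weight J w ` M"
    by (auto simp: scenario_covering_def)
next
  assume rep: "M \<subseteq> st_paths G s t \<and>
    mosp_weight J w ` efficient_paths G J w s t \<subseteq> mosp_weight J w ` M"
  have "\<exists>r\<in>M. r \<in> shortest_paths G c s t" if c: "c \<in> scenarios G l u" for c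
  proof -
    obtain p where p: "p \<in> st_paths G s t"
      and shortest: "\<And>p'. p' \<in> st_paths G s t \<Longrightarrow> path_cost c p \<le> path_cost c p'"
      using arg_min_if_finite[OF finite_st_paths nonempty, of "path_cost c"] by (metis not_less)
    obtain q where q: "q \<in> efficient_paths G J w s t"
      and le: "\<forall>j\<in>J. mosp_weight J w q j \<le> mosp_weight J w p j"
      using ex_efficient_path_below[OF finite_st_paths _ p, of J w]
      unfolding J_def by (metis finite_extremal_scenarios)
    obtain r where r: "r \<in> M" "mosp_weight J w r = mosp_weight J w q"
      using rep q by (metis image_iff subsetD image_eqI)
    have "r \<in> st_paths G s t" using r rep by blast
    moreover have "path_cost c r \<le> path_cost c p"
      using no_worse_in_all_scenarios[OF p \<open>r \<in> st_paths G s t\<close> c] le r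
      by (simp add: J_def w_def)
    ultimately have "r \<in> shortest_paths G c s t"
      using shortest by (force simp: shortest_paths_def)
    with r show ?thesis by blast
  qed
  with rep show "scenario_covering G l u s t M" by (auto simp: scenario_covering_def)
qed

lemma scenario_covering_nonempty_st_paths:
  "scenario_covering G l u s t M \<Longrightarrow> st_paths G s t \<noteq> {}"
  using best_case_scenario by (auto simp: scenario_covering_def)

text \<open>A member of an essential set whose weight is not that of an efficient path could be removed
  without losing coverage; hence the weights are those of efficient paths, and the members
  themselves are efficient. On both sides, minimality then refers to the same condition.\<close>

lemma essential_iff_minimal_efficient_set:
  fixes s t
  defines "J \<equiv> extremal_scenarios G l u" and "w \<equiv> induced_weight G l u"
  assumes nonempty: "st_paths G s t \<noteq> {}"
  shows "essential G l u s t M \<longleftrightarrow> minimal_efficient_set G J w s t M"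
proof -
  let ?W = "mosp_weight J w" and ?E = "efficient_paths G J w s t"
  note covering_iff = scenario_covering_iff_efficient_weights[OF nonempty, folded J_def w_def]
  have "minimal_efficient_set G J w s t M" if "essential G l u s t M"
  proof -
    from that have sub: "M \<subseteq> st_paths G s t" and rep: "?W ` ?E \<subseteq> ?W ` M"
      and irredundant: "\<And>p. p \<in> M \<Longrightarrow> \<not> ?W ` ?E \<subseteq> ?W ` (M - {p})"
      by (auto simp: essential_def covering_iff)
    have weights: "?W p \<in> ?W ` ?E" if "p \<in> M" for p
    proof (rule ccontr)
      assume "?W p \<notin> ?W ` ?E"
      then have "?W ` ?E \<subseteq> ?W ` M - {?W p}" using rep by (simp add: subset_Diff_insert)
      also have "\<dots> \<subseteq> ?W ` (M - {p})" using image_diff_subset[of ?W M "{p}"] by simp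
      finally show False using irredundant[OF that] by simp
    qed
    have "M \<subseteq> ?E"
    proof
      fix p assume p: "p \<in> M"
      then obtain e where "e \<in> ?E" "?W p = ?W e" by (rule imageE[OF weights])
      moreover have "p \<in> st_paths G s t" using p sub by blast
      ultimately show "p \<in> ?E" using efficient_paths_same_weight[of e G J w s t p] by simp
    qed
    moreover have "\<not> (\<exists>M'. M' \<subset> M \<and> ?W ` M' = ?W ` ?E)"
    proof
      assume "\<exists>M'. M' \<subset> M \<and> ?W ` M' = ?W ` ?E"
      then obtain M' where M': "M' \<subset> M" "?W ` M' = ?W ` ?E" by (elim exE conjE)
      then obtain p where p: "p \<in> M" "p \<notin> M'" using psubset_imp_ex_mem[of M' M] by auto
      with M' have "M' \<subseteq> M - {p}" by (simp add: psubset_imp_subset subset_Diff_insert)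
      then have "?W ` M' \<subseteq> ?W ` (M - {p})" by (rule image_mono)
      with M' show False using irredundant[OF p(1)] by simp
    qed
    moreover have "?W ` M = ?W ` ?E"
      using rep weights by (simp add: subset_antisym image_subsetI)
    ultimately show ?thesis unfolding minimal_efficient_set_def by simp
  qed
  moreover have "essential G l u s t M" if "minimal_efficient_set G J w s t M"
  proof -
    from that have sub: "M \<subseteq> ?E" and eq: "?W ` M = ?W ` ?E"
      and minimal: "\<And>M'. M' \<subset> M \<Longrightarrow> ?W ` M' \<noteq> ?W ` ?E"
      by (simp_all add: minimal_efficient_set_def)
    have "scenario_covering G l u s t M"
      using sub eq by (auto simp: covering_iff efficient_paths_def)
    moreover have "\<not> scenario_covering G l u s t (M - {p})" if p: "p \<in> M" for p
    proof
      assume "scenario_covering G l u s t (M - {p})"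
      then have "?W ` ?E \<subseteq> ?W ` (M - {p})" by (simp add: covering_iff)
      moreover have "?W ` (M - {p}) \<subseteq> ?W ` M" by (rule image_mono) simp
      ultimately have "?W ` (M - {p}) = ?W ` ?E" using eq by simp
      then show False using minimal[of "M - {p}"] p by blast
    qed
    ultimately show ?thesis by (simp add: essential_def)
  qed
  ultimately show ?thesis by blast
qed

end

theorem theorem25:
  fixes G :: "('v, 'a) pre_digraph" and l u :: "'a \<Rightarrow> real" and s t :: 'v
    and J :: "('a \<Rightarrow> real) set" and w :: "'a \<Rightarrow> ('a \<Rightarrow> real) \<Rightarrow> real"
  assumes "interval_graph G l u"
    and "s \<in> verts G" and "t \<in> verts G"
  defines "J \<equiv> extremal_scenarios G l u"
    and "w \<equiv> induced_weight G l u"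
  shows "complete_paths G l u s t = weakly_efficient_paths G J w s t \<and>
    (\<forall>M. essential G l u s t M \<longrightarrow>
      mosp_weight J w ` M = mosp_weight J w ` efficient_paths G J w s t) \<and>
    (\<forall>M. essential G l u s t M \<longrightarrow> minimal_efficient_set G J w s t M) \<and>
    (st_paths G s t \<noteq> {} \<longrightarrow>
      (\<forall>M. essential G l u s t M \<longleftrightarrow> minimal_efficient_set G J w s t M))"
proof -
  interpret interval_graph G l u by fact
  note iff = essential_iff_minimal_efficient_set[of s t, folded J_def w_def]
  \<comment> \<open>An essential set covers some scenario, so its existence already provides a path; without
    paths the empty set is a minimal set of efficient paths that covers nothing.\<close>
  have "minimal_efficient_set G J w s t M" if "essential G l u s t M" for M
    using that iff scenario_covering_nonempty_st_paths by (metis essential_def)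
  moreover from this have "mosp_weight J w ` M = mosp_weight J w ` efficient_paths G J w s t"
    if "essential G l u s t M" for M
    using that by (simp add: minimal_efficient_set_def)
  ultimately show ?thesis
    using iff complete_paths_eq_weakly_efficient_paths[of s t, folded J_def w_def] by blast
qed

end
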